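(* For every positive integer $n$ there exist infinitely many integers $h$ such that the pair of simultaneous equations in the five variables $x_1,x_2,x_4,x_5,x_6$ $$\begin{aligned} &72(9x_1^3-9hx_1^2x_2-18(h+2)x_1x_2^2-8(h+3)x_2^3)(3x_1^2+6x_1x_2+4x_2^2)\\ &=13\{81x_4^3-81hx_4^2x_5+81(h^2+4h+8)x_4^2x_6-162(h+2)x_4x_5^2\\ &\quad+(162h^2+540h+648)x_4x_5x_6+(180h^2+864h+1296)x_4x_6^2\\ &\quad-72(h+3)x_5^3+72h(h+3)x_5^2x_6+144(h+3)(h+2)x_5x_6^2+64(h+3)^2x_6^3\}\\ &\quad\times\{(x_4+x_5+x_6)^2+(h+3)(49x_4^2-36x_5^2+x_6^2)\} \end{aligned}$$ and $$\begin{aligned} &648x_1^3-648hx_1^2x_2-1296(h+2)x_1x_2^2-576(h+3)x_2^3-81x_4^3\\ &+81hx_4^2x_5-81(h^2+4h+8)x_4^2x_6+162(h+2)x_4x_5^2\\ &-54(3h^2+10h+12)x_4x_5x_6-36(5h^2+24h+36)x_4x_6^2+72(h+3)x_5^3\\ &-72h(h+3)x_5^2x_6-144(h+2)(h+3)x_5x_6^2-64(h+3)^2x_6^3=0 \end{aligned}$$ has at least $n$ distinct rational (hence, on scaling, integer) solutions with $(x_1,x_2)\neq(0,0)$ and $(x_4,x_5,x_6)\neq(0,0,0)$.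
   Context: Solutions differing by a nonzero rational scalar factor are regarded as equivalent and counted once. *)

theory Defs imports Complex_Main begin

definition equation1 :: "rat \<Rightarrow> rat \<Rightarrow> rat \<Rightarrow> rat \<Rightarrow> rat \<Rightarrow> rat \<Rightarrow> bool" where
  "equation1 h x1 x2 x4 x5 x6 \<longleftrightarrow>
     72 * (9 * x1^3 - 9 * h * x1^2 * x2 - 18 * (h + 2) * x1 * x2^2 - 8 * (h + 3) * x2^3)
        * (3 * x1^2 + 6 * x1 * x2 + 4 * x2^2)
     = 13 * (81 * x4^3 - 81 * h * x4^2 * x5 + 81 * (h^2 + 4 * h + 8) * x4^2 * x6
             - 162 * (h + 2) * x4 * x5^2
             + (162 * h^2 + 540 * h + 648) * x4 * x5 * x6
             + (180 * h^2 + 864 * h + 1296) * x4 * x6^2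
             - 72 * (h + 3) * x5^3 + 72 * h * (h + 3) * x5^2 * x6
             + 144 * (h + 3) * (h + 2) * x5 * x6^2 + 64 * (h + 3)^2 * x6^3)
          * ((x4 + x5 + x6)^2 + (h + 3) * (49 * x4^2 - 36 * x5^2 + x6^2))"

definition equation2 :: "rat \<Rightarrow> rat \<Rightarrow> rat \<Rightarrow> rat \<Rightarrow> rat \<Rightarrow> rat \<Rightarrow> bool" where
  "equation2 h x1 x2 x4 x5 x6 \<longleftrightarrow>
     648 * x1^3 - 648 * h * x1^2 * x2 - 1296 * (h + 2) * x1 * x2^2 - 576 * (h + 3) * x2^3
     - 81 * x4^3
     + 81 * h * x4^2 * x5 - 81 * (h^2 + 4 * h + 8) * x4^2 * x6 + 162 * (h + 2) * x4 * x5^2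
     - 54 * (3 * h^2 + 10 * h + 12) * x4 * x5 * x6
     - 36 * (5 * h^2 + 24 * h + 36) * x4 * x6^2 + 72 * (h + 3) * x5^3
     - 72 * h * (h + 3) * x5^2 * x6 - 144 * (h + 2) * (h + 3) * x5 * x6^2
     - 64 * (h + 3)^2 * x6^3 = 0"

type_synonym quintuple = "rat \<times> rat \<times> rat \<times> rat \<times> rat"

definition solutions :: "int \<Rightarrow> quintuple set" where
  "solutions h = {(x1, x2, x4, x5, x6).
     equation1 (of_int h) x1 x2 x4 x5 x6 \<and> equation2 (of_int h) x1 x2 x4 x5 x6 \<and>
     (x1, x2) \<noteq> (0, 0) \<and> (x4, x5, x6) \<noteq> (0, 0, 0)}"

fun scale5 :: "rat \<Rightarrow> quintuple \<Rightarrow> quintuple" where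
  "scale5 c (x1, x2, x4, x5, x6) = (c * x1, c * x2, c * x4, c * x5, c * x6)"

definition proportional :: "quintuple \<Rightarrow> quintuple \<Rightarrow> bool" where
  "proportional x y \<longleftrightarrow> (\<exists>c. c \<noteq> 0 \<and> y = scale5 c x)"

definition integral5 :: "quintuple \<Rightarrow> bool" where
  "integral5 = (\<lambda>(x1, x2, x4, x5, x6). {x1, x2, x4, x5, x6} \<subseteq> \<int>)"

end

theory Submission imports Defs "HOL-Computational_Algebra.Polynomial" begin

text \<open>
  Let \<theta> be a root of \<theta>^3 + h \<theta>^2 - 2 (h + 2) \<theta> + 8 (h + 3) / 9. Up to constant factors, the two
  cubic forms of the problem are the norms of x = x1 + x2 \<theta> and y = x4 + x5 \<theta> + x6 \<theta>^2: the
  second equation is N(y) = 8 N(x), and then the first one follows from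
  3 x1^2 + 6 x1 x2 + 4 x2^2 = 13 Q(x4, x5, x6), where Q is the quadratic factor on the right of the
  first equation. These two conditions define a surface in projective 4-space with two maps into
  itself. The cubic in x1, x2 is cyclic, so a linear map of order 3 in (x1, x2) preserves both
  N(x) and the quadratic form in x1, x2; applying it and keeping y is the first map. For the second,
  multiplicativity of the norm shows that the line of all (w, w y / x), with w ranging over the
  combinations of 1 and \<theta>, satisfies the cubic condition; it meets the quadric in (x, y) and
  hence in a second rational point. Their composite is \<^term>\<open>step\<close>, and
  \<open>on_surface_step\<close> says that it preserves the surface.

  The point (6, -7, 12, -14, 0) lies on the surface for every h. Its orbit is infinite for h = -3:
  there \<theta> takes the values 0, 1, 2, the norm is a product of three linear forms, Q is the square of
  y(1), and two steps fix x and y(1) up to a common factor while multiplying y(0)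
  by -9/4 (\<open>orbit_at_minus_3\<close>).

  Without division, the coordinates of the k-th orbit point are polynomials in h. Hence any
  polynomial expression in them that is nonzero for h = -3 vanishes for only finitely many h. So
  for all but finitely many integers h the first n orbit points are pairwise
  non-proportional solutions.
\<close>

section \<open>Cubic algebra and the two equations\<close>

text \<open>
  The norm of a + b \<theta> + c \<theta>^2, where p, q, r are the elementary symmetric functions of
  the conjugates of \<theta>, that is, \<theta>^3 = p \<theta>^2 - q \<theta> + r. The cubic need not be irreducible: the
  formulas are used as polynomial identities, also where the algebra splits.
\<close>

fun cubic_norm :: "'a :: idom \<Rightarrow> 'a \<Rightarrow> 'a \<Rightarrow> 'a \<times> 'a \<times> 'a \<Rightarrow> 'a" where
  "cubic_norm p q r (a, b, c) =
     a^3 + p * a^2 * b + (p^2 - 2 * q) * a^2 * c + q * a * b^2 + (p * q - 3 * r) * a * b * c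
     + (q^2 - 2 * p * r) * a * c^2 + r * b^3 + p * r * b^2 * c + q * r * b * c^2 + r^2 * c^3"

fun cubic_mult :: "'a :: idom \<Rightarrow> 'a \<Rightarrow> 'a \<Rightarrow> 'a \<times> 'a \<times> 'a \<Rightarrow> 'a \<times> 'a \<times> 'a
    \<Rightarrow> 'a \<times> 'a \<times> 'a" where
  "cubic_mult p q r (a, b, c) (d, e, f) =
     (a * d + r * (b * f + c * e) + p * r * (c * f),
      a * e + b * d - q * (b * f + c * e) + (r - p * q) * (c * f),
      a * f + b * e + c * d + p * (b * f + c * e) + (p^2 - q) * (c * f))"

lemma cubic_norm_mult:
  "cubic_norm p q r (cubic_mult p q r (a, b, c) (d, e, f)) =
     cubic_norm p q r (a, b, c) * cubic_norm p q r (d, e, f)"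
  by simp algebra

text \<open>
  The product of the other two conjugates of x1 + x2 \<theta>; it replaces the inverse of
  x1 + x2 \<theta> and saves the division by the norm.
\<close>

fun adjoint :: "'a :: idom \<Rightarrow> 'a \<Rightarrow> 'a \<Rightarrow> 'a \<Rightarrow> 'a \<Rightarrow> 'a \<times> 'a \<times> 'a" where
  "adjoint p q r x1 x2 = (x1^2 + p * x1 * x2 + q * x2^2, - (p * x2^2) - x1 * x2, x2^2)"

text \<open>
  With x = x1 + x2 \<theta> and z = adjoint x, this is multiplicativity of the norm applied to
  x (s + t z) = s x + t N(x).
\<close>

lemma cubic_norm_linear_pencil:
  assumes "adjoint p q r x1 x2 = (a, b, c)"
  defines "m \<equiv> cubic_norm p q r (x1, x2, 0)"
  shows "cubic_norm p q r (x1, x2, 0) * cubic_norm p q r (s + t * a, t * b, t * c) =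
     cubic_norm p q r (s * x1 + t * m, s * x2, 0)"
proof -
  have abc: "a = x1^2 + p * x1 * x2 + q * x2^2" "b = - (p * x2^2) - x1 * x2" "c = x2^2"
    using assms(1) by auto
  have "cubic_mult p q r (x1, x2, 0) (s + t * a, t * b, t * c) = (s * x1 + t * m, s * x2, 0)"
    unfolding abc m_def by (simp add: algebra_simps power2_eq_square power3_eq_cube)
  then show ?thesis
    using cubic_norm_mult[of p q r x1 x2 0 "s + t * a" "t * b" "t * c"] by simp
qed

abbreviation norm_form :: "rat \<Rightarrow> rat \<times> rat \<times> rat \<Rightarrow> rat" where
  "norm_form h \<equiv> cubic_norm (- h) (- 2 * (h + 2)) (- 8 / 9 * (h + 3))"

fun quadric :: "rat \<Rightarrow> quintuple \<Rightarrow> rat" where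
  "quadric h (x1, x2, x4, x5, x6) =
     3 * x1^2 + 6 * x1 * x2 + 4 * x2^2
     - 13 * ((x4 + x5 + x6)^2 + (h + 3) * (49 * x4^2 - 36 * x5^2 + x6^2))"

fun norm_defect :: "rat \<Rightarrow> quintuple \<Rightarrow> rat" where
  "norm_defect h (x1, x2, x4, x5, x6) = norm_form h (x4, x5, x6) - 8 * norm_form h (x1, x2, 0)"

definition on_surface :: "rat \<Rightarrow> quintuple \<Rightarrow> bool" where
  "on_surface h P \<longleftrightarrow> quadric h P = 0 \<and> norm_defect h P = 0"

lemma on_surface_equations:
  assumes "on_surface h (x1, x2, x4, x5, x6)"
  shows "equation1 h x1 x2 x4 x5 x6" "equation2 h x1 x2 x4 x5 x6"
proof -
  let ?F = "9 * x1^3 - 9 * h * x1^2 * x2 - 18 * (h + 2) * x1 * x2^2 - 8 * (h + 3) * x2^3"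
  let ?G = "81 * x4^3 - 81 * h * x4^2 * x5 + 81 * (h^2 + 4 * h + 8) * x4^2 * x6
             - 162 * (h + 2) * x4 * x5^2
             + (162 * h^2 + 540 * h + 648) * x4 * x5 * x6
             + (180 * h^2 + 864 * h + 1296) * x4 * x6^2
             - 72 * (h + 3) * x5^3 + 72 * h * (h + 3) * x5^2 * x6
             + 144 * (h + 3) * (h + 2) * x5 * x6^2 + 64 * (h + 3)^2 * x6^3"
  have F: "?F = 9 * norm_form h (x1, x2, 0)"
    by (simp add: field_simps power2_eq_square power3_eq_cube)
  have G: "?G = 81 * norm_form h (x4, x5, x6)"
    by (simp add: field_simps power2_eq_square power3_eq_cube)
  have FG: "72 * ?F = ?G"
    unfolding F G using assms by (simp add: on_surface_def del: cubic_norm.simps)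
  have Q: "3 * x1^2 + 6 * x1 * x2 + 4 * x2^2
      = 13 * ((x4 + x5 + x6)^2 + (h + 3) * (49 * x4^2 - 36 * x5^2 + x6^2))"
    using assms by (simp add: on_surface_def)
  show "equation1 h x1 x2 x4 x5 x6"
    unfolding equation1_def FG Q by (simp only: ac_simps)
  show "equation2 h x1 x2 x4 x5 x6"
    unfolding equation2_def using FG by (simp add: algebra_simps)
qed

section \<open>Scaling and integral representatives\<close>

lemma quadric_scale5: "quadric h (scale5 c P) = c^2 * quadric h P"
  by (cases P) (simp add: algebra_simps power2_eq_square)

lemma norm_defect_scale5: "norm_defect h (scale5 c P) = c^3 * norm_defect h P"
  by (cases P) (simp add: algebra_simps power2_eq_square power3_eq_cube)

lemma on_surface_scale5: "on_surface h P \<Longrightarrow> on_surface h (scale5 c P)"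
  by (simp add: on_surface_def quadric_scale5 norm_defect_scale5)

lemma scale5_scale5: "scale5 c (scale5 d P) = scale5 (c * d) P"
  by (cases P) (simp add: mult.assoc)

lemma common_denominator:
  assumes "finite (X :: rat set)"
  shows "\<exists>c. c \<noteq> 0 \<and> c \<in> \<int> \<and> (\<forall>x\<in>X. c * x \<in> \<int>)"
  using assms
proof induction
  case empty
  then show ?case by (intro exI[of _ 1]) auto
next
  case (insert x X)
  then obtain c where c: "c \<noteq> 0" "c \<in> \<int>" "\<forall>y\<in>X. c * y \<in> \<int>" by blast
  obtain a b where x: "x = of_int a / of_int b" "b > 0"
    by (metis quotient_of_div quotient_of_denom_pos surj_pair)
  have "of_int b * c * x = c * of_int a"
    using x by simp
  then have "of_int b * c * x \<in> \<int>" using c(2) by (simp only: Ints_mult Ints_of_int)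
  moreover have "\<forall>y\<in>X. of_int b * c * y \<in> \<int>"
    using c(3) by (simp add: mult.assoc)
  ultimately show ?case
    using c x(2) by (intro exI[of _ "of_int b * c"]) auto
qed

lemma integral_multiple: "\<exists>c. c \<noteq> 0 \<and> integral5 (scale5 c P)"
proof -
  obtain x1 x2 x4 x5 x6 where P: "P = (x1, x2, x4, x5, x6)" by (metis prod_cases5)
  show ?thesis
    using common_denominator[of "{x1, x2, x4, x5, x6}"]
    by (auto simp: P integral5_def)
qed

section \<open>The rational map\<close>

text \<open>
  The conjugation \<sigma> sends \<theta> to (4 - 2 \<theta>) / (4 - 3 \<theta>), and - (4 - 3 \<theta>) / 2 has norm 1. Hence
  x \<mapsto> - (4 - 3 \<theta>) / 2 \<cdot> \<sigma>(x) preserves the norm; it also maps the span of 1 and \<theta> to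
  itself, and there it is the following map.
\<close>

fun rotate_x :: "quintuple \<Rightarrow> quintuple" where
  "rotate_x (x1, x2, x4, x5, x6) = (- (2 * x1 + 2 * x2), (3 * x1 + 2 * x2) / 2, x4, x5, x6)"

text \<open>
  The point with w = 1 on the line of all (w, w y / x), multiplied by N(x) to clear denominators.
\<close>

fun companion :: "rat \<Rightarrow> quintuple \<Rightarrow> quintuple" where
  "companion h (x1, x2, x4, x5, x6) =
     (norm_form h (x1, x2, 0), 0, cubic_mult (- h) (- 2 * (h + 2)) (- 8 / 9 * (h + 3))
        (adjoint (- h) (- 2 * (h + 2)) (- 8 / 9 * (h + 3)) x1 x2) (x4, x5, x6))"

fun add5 :: "quintuple \<Rightarrow> quintuple \<Rightarrow> quintuple" where
  "add5 (x1, x2, x4, x5, x6) (y1, y2, y4, y5, y6) =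
     (x1 + y1, x2 + y2, x4 + y4, x5 + y5, x6 + y6)"

text \<open>
  If P lies on the quadric q, then s P + t R lies on it if and only if t = 0 or
  s (q(P + R) - q(P) - q(R)) + t q(R) = 0; the following point solves the latter equation.
\<close>

definition second_intersection :: "rat \<Rightarrow> quintuple \<Rightarrow> quintuple \<Rightarrow> quintuple" where
  "second_intersection h P R =
     add5 (scale5 (quadric h R) P)
          (scale5 (quadric h P + quadric h R - quadric h (add5 P R)) R)"

definition step :: "rat \<Rightarrow> quintuple \<Rightarrow> quintuple" where
  "step h P = second_intersection h (rotate_x P) (companion h (rotate_x P))"

lemma on_surface_rotate: "on_surface h P \<Longrightarrow> on_surface h (rotate_x P)"
proof -
  obtain x1 x2 x4 x5 x6 where P: "P = (x1, x2, x4, x5, x6)" by (metis prod_cases5)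
  have "quadric h (rotate_x P) = quadric h P"
    by (simp add: P) (simp add: field_simps power2_eq_square)
  moreover have "norm_defect h (rotate_x P) = norm_defect h P"
    by (simp add: P) (simp add: field_simps power2_eq_square power3_eq_cube)
  ultimately show "on_surface h P \<Longrightarrow> on_surface h (rotate_x P)"
    by (simp add: on_surface_def)
qed

lemma quadric_pencil:
  "quadric h (add5 (scale5 s P) (scale5 t R)) =
     s * (s - t) * quadric h P + t * (t - s) * quadric h R + s * t * quadric h (add5 P R)"
  by (cases P; cases R) (simp add: algebra_simps power2_eq_square)

lemma quadric_second_intersection:
  assumes "quadric h P = 0"
  shows "quadric h (second_intersection h P R) = 0"
  unfolding second_intersection_def quadric_pencil using assms
  by (simp add: algebra_simps)

text \<open>
  The whole line through P and its companion satisfies the cubic condition: its points have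
  y-part y (s + t z), where z is the adjoint of x, so their norm is N(y) N(s + t z) = 8 N(x) N(s + t z),
  which is 8 N(s x + t N(x)).
\<close>

lemma norm_defect_companion_pencil:
  assumes "norm_defect h P = 0"
  shows "norm_defect h (add5 (scale5 s P) (scale5 t (companion h P))) = 0"
proof -
  obtain x1 x2 x4 x5 x6 where P: "P = (x1, x2, x4, x5, x6)" by (metis prod_cases5)
  let ?p = "- h" and ?q = "- 2 * (h + 2)" and ?r = "- 8 / 9 * (h + 3)"
  obtain a b c where adj: "adjoint ?p ?q ?r x1 x2 = (a, b, c)" by (metis prod_cases3)
  let ?m = "norm_form h (x1, x2, 0)"
  let ?z = "(s + t * a, t * b, t * c)"
  obtain w4 w5 w6 where w: "cubic_mult ?p ?q ?r (a, b, c) (x4, x5, x6) = (w4, w5, w6)"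
    by (metis prod_cases3)
  have eq: "cubic_mult ?p ?q ?r ?z (x4, x5, x6)
      = (s * x4 + t * w4, s * x5 + t * w5, s * x6 + t * w6)"
    using w[symmetric] by (simp only: cubic_mult.simps prod.inject) (simp add: algebra_simps)
  have "norm_form h (s * x4 + t * w4, s * x5 + t * w5, s * x6 + t * w6)
      = norm_form h ?z * norm_form h (x4, x5, x6)"
    by (simp only: eq[symmetric] cubic_norm_mult)
  also have "norm_form h (x4, x5, x6) = 8 * ?m"
    using assms by (simp only: P norm_defect.simps eq_iff_diff_eq_0[symmetric])
  also have "norm_form h ?z * (8 * ?m) = 8 * norm_form h (s * x1 + t * ?m, s * x2, 0)"
    using cubic_norm_linear_pencil[OF adj, of s t] by (simp only: mult.commute mult.left_commute)
  finally show ?thesis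
    by (simp only: P companion.simps adj w scale5.simps add5.simps norm_defect.simps) simp
qed

lemma on_surface_step: "on_surface h P \<Longrightarrow> on_surface h (step h P)"
  using on_surface_rotate[of h P] quadric_second_intersection norm_defect_companion_pencil
  by (simp add: on_surface_def step_def second_intersection_def)

section \<open>The orbit\<close>

text \<open>
  Only every second iterate is taken: for h = -3 these all have the same ratio x1 : x2.
\<close>

definition orbit :: "nat \<Rightarrow> rat \<Rightarrow> quintuple" where
  "orbit k h = (step h ^^ (2 * k)) (6, -7, 12, -14, 0)"

lemma orbit_Suc: "orbit (Suc k) h = step h (step h (orbit k h))"
  by (simp add: orbit_def)

lemma on_surface_orbit: "on_surface h (orbit k h)"
proof (induction k)
  case 0
  show ?case by (simp add: orbit_def on_surface_def algebra_simps)
next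
  case (Suc k)
  then show ?case by (simp add: orbit_Suc on_surface_step)
qed

section \<open>The orbit for h = -3\<close>

lemma add5_scale5: "add5 (scale5 c P) (scale5 c R) = scale5 c (add5 P R)"
  by (cases P; cases R) (simp add: algebra_simps)

lemma companion_scale5: "companion h (scale5 c P) = scale5 (c^3) (companion h P)"
  proof -
  obtain x1 x2 x4 x5 x6 where P: "P = (x1, x2, x4, x5, x6)" by (metis prod_cases5)
  show ?thesis
    by (simp add: P) (simp add: field_simps power2_eq_square power3_eq_cube)
qed

lemma rotate_scale5: "rotate_x (scale5 c P) = scale5 c (rotate_x P)"
  by (cases P) (simp add: algebra_simps)

text \<open>
  The companion of P is cubic in P, which explains the exponent in the second argument.
\<close>

lemma second_intersection_scale5:
  "second_intersection h (scale5 c P) (scale5 (c^3) R) = scale5 (c^7) (second_intersection h P R)"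
proof -
  let ?polar = "quadric h P + quadric h R - quadric h (add5 P R)"
  have "quadric h (scale5 c P) + quadric h (scale5 (c^3) R)
      - quadric h (add5 (scale5 c P) (scale5 (c^3) R)) = c^4 * ?polar"
    unfolding quadric_pencil quadric_scale5 by algebra
  moreover have pow: "(c^3)^2 * x * c = c^7 * x" "c^4 * x * c^3 = c^7 * x" for x
    by algebra+
  ultimately show ?thesis
    by (simp only: second_intersection_def quadric_scale5 scale5_scale5 add5_scale5[symmetric] pow)
qed

lemma step_scale5: "step h (scale5 c P) = scale5 (c^7) (step h P)"
  by (simp add: step_def rotate_scale5 companion_scale5 second_intersection_scale5)

text \<open>
  For h = -3 the values of \<theta> are 0, 1, 2, and y is determined by its values there. Here
  these are a, -2 and c.
\<close>

fun spectral_point :: "rat \<Rightarrow> rat \<Rightarrow> rat \<Rightarrow> rat \<Rightarrow> quintuple" where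
  "spectral_point x1 x2 a c = (x1, x2, a, - (4 + 3 * a + c) / 2 - 2, (a + 4 + c) / 2)"

text \<open>
  For h = -3 the condition of the quadric reads 3 x(1)^2 + x2^2 = 13 y(1)^2, and y / x is constant along
  the line joining a point to its companion. The second intersection therefore changes the sign of x2
  relative to x(1): it exchanges x(0) and x(2), while y(0) and y(2) change so that
  y(0) / x(0) and y(2) / x(2) stay the same. Together with the rotation this explains the factors in the two
  lemmas below.
\<close>

lemma step_spectral_point_1:
  "step (- 3) (spectral_point 6 (- 7) a c) = scale5 576 (spectral_point 6 (- 2) (3 * a) (c / 3))"
  by (simp add: step_def second_intersection_def) (simp add: field_simps power2_eq_square)

lemma step_spectral_point_2:
  "step (- 3) (spectral_point 6 (- 2) a c)
    = scale5 112896 (spectral_point 6 (- 7) (- 3 / 4 * a) (- 4 / 3 * c))"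
  by (simp add: step_def second_intersection_def) (simp add: field_simps power2_eq_square)

lemma orbit_at_minus_3:
  "\<exists>d. d \<noteq> 0 \<and>
     orbit k (- 3) = scale5 d (spectral_point 6 (- 7) (12 * (- 9 / 4)^k) (- 16 * (- 4 / 9)^k))"
proof (induction k)
  case 0
  show ?case by (intro exI[of _ 1]) (simp add: orbit_def)
next
  case (Suc k)
  then obtain d where d: "d \<noteq> 0"
    "orbit k (- 3) = scale5 d (spectral_point 6 (- 7) (12 * (- 9 / 4)^k) (- 16 * (- 4 / 9)^k))"
    by blast
  let ?e = "(d^7 * 576)^7 * 112896"
  have "orbit (Suc k) (- 3) = scale5 ?e (spectral_point 6 (- 7)
      (- 3 / 4 * (3 * (12 * (- 9 / 4)^k))) (- 4 / 3 * (- 16 * (- 4 / 9)^k / 3)))"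
    by (simp only: orbit_Suc d(2) step_scale5 step_spectral_point_1 step_spectral_point_2
        scale5_scale5)
  moreover have "- 3 / 4 * (3 * (12 * (- 9 / 4)^k)) = (12 * (- 9 / 4)^Suc k :: rat)"
    "- 4 / 3 * (- 16 * (- 4 / 9)^k / 3) = (- 16 * (- 4 / 9)^Suc k :: rat)"
    by simp_all
  moreover have "?e \<noteq> 0" using d(1) by simp
  ultimately show ?case by metis
qed

section \<open>Polynomial dependence on h\<close>

definition polyfun :: "(rat \<Rightarrow> rat) \<Rightarrow> bool" where
  "polyfun f \<longleftrightarrow> (\<exists>p. \<forall>x. f x = poly p x)"

lemma polyfun_const: "polyfun (\<lambda>h. c)"
  unfolding polyfun_def by (rule exI[of _ "[:c:]"]) auto

lemma polyfun_id: "polyfun (\<lambda>h. h)"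
  unfolding polyfun_def by (rule exI[of _ "[:0, 1:]"]) auto

lemma polyfun_add: "polyfun f \<Longrightarrow> polyfun g \<Longrightarrow> polyfun (\<lambda>h. f h + g h)"
  unfolding polyfun_def by (metis poly_add)

lemma polyfun_diff: "polyfun f \<Longrightarrow> polyfun g \<Longrightarrow> polyfun (\<lambda>h. f h - g h)"
  unfolding polyfun_def by (metis poly_diff)

lemma polyfun_minus: "polyfun f \<Longrightarrow> polyfun (\<lambda>h. - f h)"
  unfolding polyfun_def by (metis poly_minus)

lemma polyfun_mult: "polyfun f \<Longrightarrow> polyfun g \<Longrightarrow> polyfun (\<lambda>h. f h * g h)"
  unfolding polyfun_def by (metis poly_mult)

lemma polyfun_power: "polyfun f \<Longrightarrow> polyfun (\<lambda>h. f h ^ n)"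
  unfolding polyfun_def by (metis poly_power)

lemma polyfun_divide: "polyfun f \<Longrightarrow> polyfun (\<lambda>h. f h / c)"
  using polyfun_mult[OF _ polyfun_const[of "inverse c"]] by (simp add: divide_inverse)

lemmas polyfun_intros = polyfun_const polyfun_id polyfun_add polyfun_diff polyfun_minus
  polyfun_mult polyfun_power polyfun_divide

text \<open>
  This transfers what is known at the single parameter z = -3 to almost all integers h.
\<close>

lemma finite_integer_zeros:
  assumes "polyfun f" "f z \<noteq> 0"
  shows "finite {h :: int. f (of_int h) = 0}"
proof -
  obtain p where p: "\<And>x. f x = poly p x" using assms(1) by (auto simp: polyfun_def)
  have "finite {x. poly p x = 0}" using assms(2) p by (intro poly_roots_finite) auto
  then have "finite (of_int -` {x. poly p x = 0} :: int set)"
    by (rule finite_vimageI) (simp add: inj_on_def)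
  then show ?thesis by (simp add: p vimage_def)
qed

definition polypoint :: "(rat \<Rightarrow> quintuple) \<Rightarrow> bool" where
  "polypoint P \<longleftrightarrow> (\<exists>x1 x2 x4 x5 x6. polyfun x1 \<and> polyfun x2 \<and> polyfun x4 \<and> polyfun x5 \<and> polyfun x6
      \<and> P = (\<lambda>h. (x1 h, x2 h, x4 h, x5 h, x6 h)))"

lemma polypointE:
  assumes "polypoint P"
  obtains x1 x2 x4 x5 x6 where "polyfun x1" "polyfun x2" "polyfun x4" "polyfun x5" "polyfun x6"
    "P = (\<lambda>h. (x1 h, x2 h, x4 h, x5 h, x6 h))"
  using assms unfolding polypoint_def by blast

lemma polypointI:
  assumes "polyfun x1" "polyfun x2" "polyfun x4" "polyfun x5" "polyfun x6"
  shows "polypoint (\<lambda>h. (x1 h, x2 h, x4 h, x5 h, x6 h))"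
  using assms unfolding polypoint_def by blast

lemma polyfun_quadric:
  assumes "polypoint P" shows "polyfun (\<lambda>h. quadric h (P h))"
  using assms by (rule polypointE) (simp, intro polyfun_intros)

lemma polypoint_rotate:
  assumes "polypoint P" shows "polypoint (\<lambda>h. rotate_x (P h))"
  using assms by (rule polypointE) (simp only: rotate_x.simps, intro polypointI polyfun_intros)

lemma polypoint_companion:
  assumes "polypoint P" shows "polypoint (\<lambda>h. companion h (P h))"
  using assms
  by (rule polypointE)
     (simp only: companion.simps cubic_norm.simps adjoint.simps cubic_mult.simps,
      intro polypointI polyfun_intros)

lemma polypoint_scale5:
  assumes "polyfun c" "polypoint P" shows "polypoint (\<lambda>h. scale5 (c h) (P h))"
  using assms(2)
  by (rule polypointE) (simp only: scale5.simps, intro polypointI polyfun_intros assms(1))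

lemma polypoint_add5:
  assumes "polypoint P" "polypoint R" shows "polypoint (\<lambda>h. add5 (P h) (R h))"
  by (rule polypointE[OF assms(1)], rule polypointE[OF assms(2)])
     (simp only: add5.simps, intro polypointI polyfun_intros)

lemma polypoint_step:
  assumes "polypoint P" shows "polypoint (\<lambda>h. step h (P h))"
  unfolding step_def second_intersection_def
  by (intro polypoint_add5 polypoint_scale5 polyfun_quadric polyfun_add polyfun_diff
      polypoint_rotate polypoint_companion assms)

lemma polypoint_orbit: "polypoint (orbit k)"
proof (induction k)
  case 0
  show ?case
    unfolding orbit_def by (simp only: mult_0_right funpow_0) (intro polypointI polyfun_const)
next
  case (Suc k)
  then have "polypoint (\<lambda>h. step h (step h (orbit k h)))" by (intro polypoint_step)
  then show ?case by (simp only: orbit_Suc[abs_def])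
qed

section \<open>Infinitely many h\<close>

text \<open>
  The 2 by 2 minor formed from y(0) and y(1), the two values of y whose ratio
  distinguishes the orbit points for h = -3.
\<close>

fun minor :: "quintuple \<Rightarrow> quintuple \<Rightarrow> rat" where
  "minor (x1, x2, x4, x5, x6) (y1, y2, y4, y5, y6) =
     x4 * (y4 + y5 + y6) - y4 * (x4 + x5 + x6)"

lemma minor_scale5: "minor (scale5 c P) (scale5 d R) = c * d * minor P R"
  by (cases P; cases R) (simp add: algebra_simps)

lemma minor_proportional: "proportional P R \<Longrightarrow> minor P R = 0"
  by (cases P; cases R) (auto simp: proportional_def algebra_simps)

lemma proportional_refl: "proportional P P"
  by (cases P) (auto simp: proportional_def intro!: exI[of _ 1])

text \<open>
  A single polynomial whose nonvanishing excludes both (x1, x2) = 0 and (x4, x5, x6) = 0.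
\<close>

fun lead_product :: "quintuple \<Rightarrow> rat" where
  "lead_product (x1, x2, x4, x5, x6) = x1 * x4"

lemma solutions_on_surface:
  assumes "on_surface (of_int h) P" "lead_product P \<noteq> 0"
  shows "P \<in> solutions h"
proof -
  obtain x1 x2 x4 x5 x6 where P: "P = (x1, x2, x4, x5, x6)" by (metis prod_cases5)
  show ?thesis
    using assms on_surface_equations[of "of_int h" x1 x2 x4 x5 x6]
    by (auto simp: P solutions_def)
qed

lemma lead_product_scale5: "lead_product (scale5 c P) = c^2 * lead_product P"
  by (cases P) (simp add: power2_eq_square)

lemma finite_degenerate_parameters: "finite {h :: int. lead_product (orbit k (of_int h)) = 0}"
proof (rule finite_integer_zeros)
  show "polyfun (\<lambda>h. lead_product (orbit k h))"
    using polypoint_orbit[of k] by (rule polypointE) (simp add: polyfun_mult)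
  show "lead_product (orbit k (- 3)) \<noteq> 0"
    using orbit_at_minus_3[of k] by (auto simp: lead_product_scale5 simp del: scale5.simps)
qed

lemma finite_coincidence_parameters:
  assumes "k \<noteq> l"
  shows "finite {h :: int. minor (orbit k (of_int h)) (orbit l (of_int h)) = 0}"
proof (rule finite_integer_zeros)
  show "polyfun (\<lambda>h. minor (orbit k h) (orbit l h))"
    by (rule polypointE[OF polypoint_orbit[of k]], rule polypointE[OF polypoint_orbit[of l]])
       (simp, intro polyfun_intros)
  have "(- 9 / 4 :: rat)^k \<noteq> (- 9 / 4)^l"
  proof
    assume "(- 9 / 4 :: rat)^k = (- 9 / 4)^l"
    then have "\<bar>- 9 / 4 :: rat\<bar>^k = \<bar>- 9 / 4\<bar>^l" by (simp only: power_abs[symmetric])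
    then show False using assms by (simp add: power_inject_exp)
  qed
  moreover have "minor (spectral_point 6 (- 7) a c) (spectral_point 6 (- 7) a' c') = 2 * (a' - a)"
    for a c a' c' by (simp add: field_simps)
  moreover obtain d where "d \<noteq> 0"
    "orbit k (- 3) = scale5 d (spectral_point 6 (- 7) (12 * (- 9 / 4)^k) (- 16 * (- 4 / 9)^k))"
    using orbit_at_minus_3 by blast
  moreover obtain e where "e \<noteq> 0"
    "orbit l (- 3) = scale5 e (spectral_point 6 (- 7) (12 * (- 9 / 4)^l) (- 16 * (- 4 / 9)^l))"
    using orbit_at_minus_3 by blast
  ultimately show "minor (orbit k (- 3)) (orbit l (- 3)) \<noteq> 0"
    by (simp only: minor_scale5) simp
qed

theorem mainTheorem11:
  fixes n :: nat
  assumes "n \<ge> 1"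
  shows "infinite {h :: int. \<exists>S. S \<subseteq> solutions h \<and> finite S \<and> card S = n \<and>
           pairwise (\<lambda>x y. \<not> proportional x y) S \<and>
           (\<forall>x\<in>S. \<exists>c. c \<noteq> 0 \<and> scale5 c x \<in> solutions h \<and> integral5 (scale5 c x))}"
    (is "infinite ?H")
proof -
  define B :: "int set" where "B = (\<Union>k<n. {h. lead_product (orbit k (of_int h)) = 0})
    \<union> (\<Union>k<n. \<Union>l\<in>{..<n} - {k}. {h. minor (orbit k (of_int h)) (orbit l (of_int h)) = 0})"
  have "finite B"
    unfolding B_def
  proof (intro finite_UnI finite_UN_I finite_lessThan finite_Diff)
    fix k l assume "l \<in> {..<n} - {k}"
    then have "k \<noteq> l" by blast
    then show "finite {h :: int. minor (orbit k (of_int h)) (orbit l (of_int h)) = 0}"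
      by (rule finite_coincidence_parameters)
  qed (rule finite_degenerate_parameters)
  have "- B \<subseteq> ?H"
  proof
    fix h assume "h \<in> - B"
    have lead: "lead_product (orbit k (of_int h)) \<noteq> 0" if "k < n" for k
      using that \<open>h \<in> - B\<close> unfolding B_def by blast
    have indep: "\<not> proportional (orbit k (of_int h)) (orbit l (of_int h))"
      if "k < n" "l < n" "k \<noteq> l" for k l
    proof -
      have "minor (orbit k (of_int h)) (orbit l (of_int h)) \<noteq> 0"
        using that \<open>h \<in> - B\<close> unfolding B_def by blast
      then show ?thesis using minor_proportional by blast
    qed
    define S where "S = (\<lambda>k. orbit k (of_int h)) ` {..<n}"
    have "inj_on (\<lambda>k. orbit k (of_int h)) {..<n}"
    proof (rule inj_onI)
      fix k l assume "k \<in> {..<n}" "l \<in> {..<n}" "orbit k (of_int h) = orbit l (of_int h)"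
      then show "k = l" using indep[of k l] proportional_refl[of "orbit k (of_int h)"] by auto
    qed
    then have "card S = n" by (simp add: S_def card_image)
    moreover have "finite S" by (simp add: S_def)
    moreover have "S \<subseteq> solutions h"
      unfolding S_def
      by (intro image_subsetI solutions_on_surface on_surface_orbit lead) simp
    moreover have "pairwise (\<lambda>x y. \<not> proportional x y) S"
    proof (rule pairwiseI)
      fix x y assume "x \<in> S" "y \<in> S" "x \<noteq> y"
      then obtain k l where "k < n" "l < n" "x = orbit k (of_int h)" "y = orbit l (of_int h)"
        unfolding S_def by blast
      with \<open>x \<noteq> y\<close> show "\<not> proportional x y" using indep[of k l] by blast
    qed
    moreover have "\<forall>x\<in>S. \<exists>c. c \<noteq> 0 \<and> scale5 c x \<in> solutions h \<and> integral5 (scale5 c x)"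
    proof
      fix x assume "x \<in> S"
      then obtain k where k: "k < n" and x: "x = orbit k (of_int h)"
        unfolding S_def by blast
      obtain c where c: "c \<noteq> 0" "integral5 (scale5 c x)" using integral_multiple by blast
      have "scale5 c x \<in> solutions h"
      proof (rule solutions_on_surface)
        show "on_surface (of_int h) (scale5 c x)"
          unfolding x by (intro on_surface_scale5 on_surface_orbit)
        show "lead_product (scale5 c x) \<noteq> 0"
          unfolding x lead_product_scale5 using lead[OF k] c(1) by simp
      qed
      then show "\<exists>c. c \<noteq> 0 \<and> scale5 c x \<in> solutions h \<and> integral5 (scale5 c x)"
        using c by (intro exI[of _ c] conjI)
    qed
    ultimately show "h \<in> ?H" by (intro CollectI exI[of _ S] conjI)
  qed
  moreover have "infinite (- B)"
    using \<open>finite B\<close> by (simp add: finite_compl)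
  ultimately show ?thesis by (rule infinite_super)
qed

end
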